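(* Let $\Sigma$ be a finite alphabet with $q>1$ letters. For $n\in\mathbb{N}$ let $B(n)$ denote the number of closed words of length $n$ over $\Sigma$. Then there is a constant $c\in\mathbb{R}^+$ (possibly depending on $q$) such that \[B(n)\leq c\ln{n}\,\frac{q^{n}}{\sqrt{n}}\quad\text{for all } n>1.\]
   Context: A non-empty word $w$ is a border of the word $u$ if $|w|<|u|$ and $w$ is both a prefix and a suffix of $u$. A word $u$ having a border $w$ is closed if $u$ contains exactly two occurrences of $w$ as a factor (i.e. $w$ occurs only as a prefix and as a suffix of $u$). $\mathbb{N}$ denotes the set of positive integers and $\mathbb{R}^+$ the set of positive reals. *)

theory Defs
  imports Complex_Main "HOL-Library.Sublist"
begin

definition border :: "'a list \<Rightarrow> 'a list \<Rightarrow> bool" where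
  "border w u \<longleftrightarrow> w \<noteq> [] \<and> length w < length u \<and> prefix w u \<and> suffix w u"

text \<open>Occurrences of a factor are identified with their (0-based) starting positions,
  so overlapping occurrences are counted separately.\<close>

definition occurrences :: "'a list \<Rightarrow> 'a list \<Rightarrow> nat set" where
  "occurrences w u = {i. i + length w \<le> length u \<and> take (length w) (drop i u) = w}"

definition closed_word :: "'a list \<Rightarrow> bool" where
  "closed_word u \<longleftrightarrow> (\<exists>w. border w u \<and> card (occurrences w u) = 2)"

definition num_closed_words :: "'a set \<Rightarrow> nat \<Rightarrow> nat" where
  "num_closed_words \<Sigma> n = card {u \<in> lists \<Sigma>. length u = n \<and> closed_word u}"

end

theory Submission
  imports Defs
begin

text \<open>Fix the length \<open>m\<close> of the border \<open>w\<close>. A border of length \<open>m\<close> makes \<open>u\<close> periodic with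
  period \<open>n - m\<close>, which leaves at most \<open>q ^ (n - m)\<close> words. If \<open>2 * m \<le> n\<close>, then \<open>u = w x w\<close>, and the
  \<open>k = (n - 2 * m) div m\<close> consecutive blocks of length \<open>m\<close> in \<open>x\<close> all differ from \<open>w\<close>; by a
  Bernoulli-type inequality this leaves at most \<open>q ^ n / (q ^ m + k)\<close> words. Whether \<open>q ^ m\<close>
  is above or below \<open>sqrt n\<close>, one of the two bounds is at most \<open>q ^ n / sqrt n\<close>. This is used for
  the \<open>O(ln n)\<close> values of \<open>m\<close> with \<open>q ^ m < sqrt n\<close>; for the remaining ones the bounds
  \<open>q ^ (n - m)\<close> form a geometric series of sum at most \<open>2 * q ^ n / sqrt n\<close>.\<close>

section \<open>Closed words sorted by border length\<close>

definition closed_words_with_border :: "'a set \<Rightarrow> nat \<Rightarrow> nat \<Rightarrow> 'a list set" where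
  "closed_words_with_border \<Sigma> n m = {u \<in> lists \<Sigma>. length u = n \<and>
     (\<exists>w. length w = m \<and> border w u \<and> card (occurrences w u) = 2)}"

lemma finite_words: "finite \<Sigma> \<Longrightarrow> finite {u \<in> lists \<Sigma>. length u = n}"
  using finite_lists_length_eq[of \<Sigma> n] by (simp add: lists_eq_set conj_commute)

lemma card_words: "finite \<Sigma> \<Longrightarrow> card {u \<in> lists \<Sigma>. length u = n} = card \<Sigma> ^ n"
  using card_lists_length_eq[of \<Sigma> n] by (simp add: lists_eq_set conj_commute)

lemma finite_closed_words_with_border:
  "finite \<Sigma> \<Longrightarrow> finite (closed_words_with_border \<Sigma> n m)"
  by (rule finite_subset[OF _ finite_words[of \<Sigma> n]]) (auto simp: closed_words_with_border_def)

lemma take_in_lists: "u \<in> lists \<Sigma> \<Longrightarrow> take n u \<in> lists \<Sigma>"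
  by (auto dest: in_set_takeD)

lemma drop_in_lists: "u \<in> lists \<Sigma> \<Longrightarrow> drop n u \<in> lists \<Sigma>"
  by (auto dest: in_set_dropD)

lemma border_take_drop:
  assumes "border w u"
  shows "w = take (length w) u" "w = drop (length u - length w) u"
proof -
  show "w = take (length w) u" using assms by (auto simp: border_def prefix_def)
  show "w = drop (length u - length w) u" using assms by (auto simp: border_def suffix_def)
qed

text \<open>The two ends of \<open>u\<close> are distinct positions because \<open>w\<close> is
  shorter than \<open>u\<close>, so they exhaust a set of cardinality 2. This is what later forbids
  copies of \<open>w\<close> inside \<open>u\<close>.\<close>

lemma border_occurrences:
  assumes "border w u" "card (occurrences w u) = 2"
  shows "occurrences w u = {0, length u - length w}"
proof -
  have "{0, length u - length w} \<subseteq> occurrences w u"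
    using border_take_drop[OF assms(1), symmetric] assms(1)
    by (simp add: occurrences_def border_def del: take_all_iff drop_eq_Nil)
  moreover have "card {0, length u - length w} = 2"
    using assms(1) by (auto simp: border_def)
  \<comment> \<open>Infinite sets have cardinality 0, so cardinality 2 forces finiteness.\<close>
  moreover have "finite (occurrences w u)"
    using assms(2) by (auto intro: card_ge_0_finite)
  ultimately show ?thesis
    using assms(2) by (metis card_subset_eq)
qed

section \<open>Counting by the period\<close>

text \<open>Letters repeat at distance \<open>n - m\<close>, so the first \<open>n - m\<close>
  letters determine the word.\<close>

lemma card_closed_words_with_border_le_period:
  assumes "finite \<Sigma>"
  shows "card (closed_words_with_border \<Sigma> n m) \<le> card \<Sigma> ^ (n - m)"
proof -
  let ?C = "closed_words_with_border \<Sigma> n m"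
  have per: "length u = n \<and> m < n \<and> drop (n - m) u = take m u" if "u \<in> ?C" for u
    using that border_take_drop by (fastforce simp: closed_words_with_border_def border_def)
  have "inj_on (take (n - m)) ?C"
  proof (rule inj_onI)
    fix u v assume u: "u \<in> ?C" and v: "v \<in> ?C" and eq: "take (n - m) u = take (n - m) v"
    \<comment> \<open>Beyond the first \<open>n - m\<close> letters both words copy the letter
      \<open>n - m\<close> places to the left, which is an earlier position because
      \<open>m < n\<close>.\<close>
    have "i < n \<longrightarrow> u ! i = v ! i" for i
    proof (induction i rule: less_induct)
      case (less i)
      show ?case
      proof (cases "i < n - m")
        case True
        then show ?thesis using eq by (metis nth_take)
      next
        case False
        have shift: "x ! i = x ! (i - (n - m))" if "x \<in> ?C" "i < n" for x
        proof -
          have "drop (n - m) x ! (i - (n - m)) = take m x ! (i - (n - m))"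
            using per[OF that(1)] by simp
          moreover have "drop (n - m) x ! (i - (n - m)) = x ! i"
            using per[OF that(1)] False by (subst nth_drop) auto
          moreover have "take m x ! (i - (n - m)) = x ! (i - (n - m))"
            using per[OF that(1)] that(2) False by (intro nth_take) auto
          ultimately show ?thesis by simp
        qed
        show ?thesis
        proof
          assume "i < n"
          moreover have "i - (n - m) < i" using False per[OF u] by linarith
          ultimately show "u ! i = v ! i"
            using less[of "i - (n - m)"] shift[OF u] shift[OF v] by simp
        qed
      qed
    qed
    then show "u = v"
      using per[OF u] per[OF v] by (simp add: nth_equalityI)
  qed
  moreover have "take (n - m) ` ?C \<subseteq> {x \<in> lists \<Sigma>. length x = n - m}"
    by (auto simp: closed_words_with_border_def dest: in_set_takeD)
  ultimately have "card ?C \<le> card {x \<in> lists \<Sigma>. length x = n - m}"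
    using card_inj_on_le finite_words[OF assms] by blast
  then show ?thesis using card_words[OF assms] by simp
qed

section \<open>Counting by forbidden blocks\<close>

text \<open>Models the middle part \<open>x\<close> of \<open>u = w x w\<close>. Only disjoint
  blocks, at multiples of the length of \<open>w\<close>, are restricted, so that their choices are
  independent; the last \<open>r\<close> letters are free.\<close>

definition block_avoiding_words :: "'a set \<Rightarrow> 'a list \<Rightarrow> nat \<Rightarrow> nat \<Rightarrow> 'a list set" where
  "block_avoiding_words \<Sigma> w k r = {x \<in> lists \<Sigma>. length x = k * length w + r \<and>
     (\<forall>j<k. take (length w) (drop (j * length w) x) \<noteq> w)}"

lemma finite_block_avoiding_words: "finite \<Sigma> \<Longrightarrow> finite (block_avoiding_words \<Sigma> w k r)"
  by (rule finite_subset[OF _ finite_words[of \<Sigma> "k * length w + r"]])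
    (auto simp: block_avoiding_words_def)

text \<open>Peeling off the first block leaves a word of the same kind with one block fewer, while
  the block itself can be any word of its length except \<open>w\<close>.\<close>

lemma card_block_avoiding_words:
  assumes "finite \<Sigma>" "w \<in> lists \<Sigma>"
  shows "card (block_avoiding_words \<Sigma> w k r) \<le> (card \<Sigma> ^ length w - 1) ^ k * card \<Sigma> ^ r"
proof (induction k)
  case 0
  then show ?case using card_words[OF assms(1)] by (simp add: block_avoiding_words_def)
next
  case (Suc k)
  let ?m = "length w"
  let ?W = "{x \<in> lists \<Sigma>. length x = ?m} - {w}"
  have inj: "inj_on (\<lambda>x. (take ?m x, drop ?m x)) (block_avoiding_words \<Sigma> w (Suc k) r)"
    by (rule inj_onI) (metis append_take_drop_id prod.inject)
  have "take ?m x \<in> ?W \<and> drop ?m x \<in> block_avoiding_words \<Sigma> w k r"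
    if x: "x \<in> block_avoiding_words \<Sigma> w (Suc k) r" for x
  proof -
    have avoid: "take ?m (drop (j * ?m) x) \<noteq> w" if "j < Suc k" for j
      using x that by (auto simp: block_avoiding_words_def)
    have "take ?m (drop (j * ?m) (drop ?m x)) \<noteq> w" if "j < k" for j
      using avoid[of "Suc j"] that by (simp add: add.commute)
    then show ?thesis
      using x avoid[of 0] take_in_lists[of x \<Sigma> ?m] drop_in_lists[of x \<Sigma> ?m]
      by (simp add: block_avoiding_words_def)
  qed
  then have "(\<lambda>x. (take ?m x, drop ?m x)) ` block_avoiding_words \<Sigma> w (Suc k) r
      \<subseteq> ?W \<times> block_avoiding_words \<Sigma> w k r"
    by blast
  then have "card (block_avoiding_words \<Sigma> w (Suc k) r)
      \<le> card (?W \<times> block_avoiding_words \<Sigma> w k r)"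
    using finite_words[OF assms(1)] finite_block_avoiding_words[OF assms(1)]
    by (intro card_inj_on_le[OF inj]) auto
  also have "\<dots> = (card \<Sigma> ^ ?m - 1) * card (block_avoiding_words \<Sigma> w k r)"
    using assms by (simp add: card_cartesian_product card_words finite_words)
  also have "\<dots> \<le> (card \<Sigma> ^ ?m - 1) * ((card \<Sigma> ^ ?m - 1) ^ k * card \<Sigma> ^ r)"
    using Suc.IH by (rule mult_le_mono2)
  finally show ?case by (simp add: mult.assoc)
qed

text \<open>The pair \<open>(w, x)\<close> determines \<open>u = w x w\<close>; the three factors
  count the border, the \<open>k\<close> blocks of \<open>x\<close> and its remainder.\<close>

lemma card_closed_words_with_border_le_blocks:
  assumes "finite \<Sigma>" "n = 2 * m + k * m + r"
  shows "card (closed_words_with_border \<Sigma> n m)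
    \<le> card \<Sigma> ^ m * ((card \<Sigma> ^ m - 1) ^ k * card \<Sigma> ^ r)"
proof -
  let ?C = "closed_words_with_border \<Sigma> n m"
  let ?W = "{w \<in> lists \<Sigma>. length w = m}"
  let ?S = "SIGMA w:?W. block_avoiding_words \<Sigma> w k r"
  let ?f = "\<lambda>u. (take m u, take (n - 2 * m) (drop m u))"
  have decomp: "take m u @ take (n - 2 * m) (drop m u) @ take m u = u \<and> ?f u \<in> ?S"
    if u: "u \<in> ?C" for u
  proof -
    obtain w where w: "length w = m" "border w u" "card (occurrences w u) = 2"
      and lu: "length u = n" and uS: "u \<in> lists \<Sigma>"
      using u by (auto simp: closed_words_with_border_def)
    have tk: "take m u = w" and dr: "drop (n - m) u = w"
      using border_take_drop[OF w(2)] w(1) lu by simp_all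
    have "u = take m u @ take (n - 2 * m) (drop m u) @ drop (n - 2 * m) (drop m u)"
      by (metis append_take_drop_id)
    moreover have "n - 2 * m + m = n - m" using assms(2) by simp
    ultimately have eq: "take m u @ take (n - 2 * m) (drop m u) @ take m u = u"
      using tk dr by (metis drop_drop)
    \<comment> \<open>Block \<open>j\<close> of the middle part starts at position
      \<open>(j + 1) * m\<close> of \<open>u\<close>. As \<open>j < k\<close> and
      \<open>m > 0\<close>, this lies strictly between 0 and \<open>n - m\<close>, so a copy of
      \<open>w\<close> there would be a third occurrence.\<close>
    have "take m (drop (j * m) (take (n - 2 * m) (drop m u))) \<noteq> w" if j: "j < k" for j
    proof
      assume a: "take m (drop (j * m) (take (n - 2 * m) (drop m u))) = w"
      have "Suc j * m \<le> k * m" using j by (intro mult_le_mono1) simp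
      then have le: "j * m + m \<le> k * m" by simp
      have "m > 0" using w by (auto simp: border_def)
      have "take m (drop (j * m + m) u) = w"
        using a le assms(2) by (simp add: drop_take min_def split: if_splits)
      then have "j * m + m \<in> occurrences w u"
        using le lu assms(2) w(1) by (simp add: occurrences_def)
      then show False
        using border_occurrences[OF w(2,3)] lu w(1) le assms(2) \<open>m > 0\<close> by auto
    qed
    moreover have "take (n - 2 * m) (drop m u) \<in> lists \<Sigma>"
      using uS by (intro take_in_lists drop_in_lists)
    moreover have "length (take (n - 2 * m) (drop m u)) = k * m + r"
      using lu assms(2) by simp
    ultimately have "take (n - 2 * m) (drop m u) \<in> block_avoiding_words \<Sigma> w k r"
      using w(1) by (simp add: block_avoiding_words_def)
    moreover have "w \<in> ?W" using take_in_lists[OF uS, of m] tk w(1) by simp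
    ultimately show ?thesis using eq tk by simp
  qed
  have "inj_on ?f ?C"
    by (rule inj_onI) (metis decomp prod.inject)
  moreover have "?f ` ?C \<subseteq> ?S" using decomp by blast
  moreover have "finite ?S"
    using finite_words[OF assms(1)] finite_block_avoiding_words[OF assms(1)]
    by (intro finite_SigmaI) auto
  ultimately have "card ?C \<le> card ?S" by (rule card_inj_on_le)
  also have "\<dots> = (\<Sum>w\<in>?W. card (block_avoiding_words \<Sigma> w k r))"
    using finite_words[OF assms(1)] finite_block_avoiding_words[OF assms(1)]
    by (intro card_SigmaI) auto
  also have "\<dots> \<le> of_nat (card ?W) * ((card \<Sigma> ^ m - 1) ^ k * card \<Sigma> ^ r)"
    using card_block_avoiding_words[OF assms(1)] by (intro sum_bounded_above) auto
  finally show ?thesis using card_words[OF assms(1)] by simp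
qed

section \<open>A bound for each border length\<close>

text \<open>A division-free form of \<open>(1 - 1/a) ^ k \<le> a / (a + k)\<close>, which turns the
  block count into a quotient by \<open>a + k\<close>.\<close>

lemma pred_power_mult_add_le:
  fixes a :: nat
  assumes "a > 0"
  shows "(a - 1) ^ k * (a + k) \<le> a ^ (k + 1)"
proof (induction k)
  case (Suc k)
  obtain b where b: "a = Suc b" using assms by (cases a) auto
  \<comment> \<open>The right side exceeds the left side by \<open>k + 1\<close>.\<close>
  have "(a - 1) * (a + Suc k) \<le> a * (a + k)"
    by (simp add: b algebra_simps)
  then have "(a - 1) ^ k * ((a - 1) * (a + Suc k)) \<le> (a - 1) ^ k * (a * (a + k))"
    by (rule mult_le_mono2)
  then have "(a - 1) ^ Suc k * (a + Suc k) \<le> a * ((a - 1) ^ k * (a + k))"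
    by (simp only: power_Suc mult.assoc mult.left_commute)
  also have "\<dots> \<le> a * a ^ (k + 1)" using Suc.IH by (rule mult_le_mono2)
  finally show ?case by simp
qed simp

lemma card_closed_words_with_border_le_sqrt:
  assumes "finite \<Sigma>" "card \<Sigma> > 1" "n > 1" "m > 0"
  shows "real (card (closed_words_with_border \<Sigma> n m)) \<le> real (card \<Sigma>) ^ n / sqrt (real n)"
proof (cases "sqrt (real n) \<le> real (card \<Sigma>) ^ m")
  case True
  let ?q = "card \<Sigma>"
  show ?thesis
  \<comment> \<open>Subtraction is truncated, so \<open>q ^ (n - m) * q ^ m = q ^ n\<close> needs
    \<open>m \<le> n\<close>; for larger \<open>m\<close> no border of that length exists.\<close>
  proof (cases "m \<le> n")
    case le: True
    have "real (card (closed_words_with_border \<Sigma> n m)) * sqrt (real n)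
        \<le> real ?q ^ (n - m) * real ?q ^ m"
      using True card_closed_words_with_border_le_period[OF assms(1), of n m]
      by (intro mult_mono) (simp_all flip: of_nat_power)
    also have "\<dots> = real ?q ^ n" using le by (simp flip: power_add)
    finally show ?thesis using assms(3) by (simp add: field_simps)
  next
    case False
    then have "closed_words_with_border \<Sigma> n m = {}"
      by (auto simp: closed_words_with_border_def border_def)
    then show ?thesis by simp
  qed
next
  case False
  let ?q = "card \<Sigma>"
  define a where "a = ?q ^ m"
  have lt: "real a < sqrt (real n)" using False by (simp add: a_def)
  \<comment> \<open>The chain \<open>m < 2 ^ m \<le> a < sqrt n\<close> yields
    \<open>m * m < n\<close>, from which it follows that the two copies of the border do not
    overlap.\<close>
  have "m < 2 ^ m" by simp
  also have "2 ^ m \<le> a" using assms(2) by (auto simp: a_def intro: power_mono)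
  finally have ma: "m < a" .
  then have m_sqrt: "real m < sqrt (real n)" using lt by linarith
  have "real m * real m < sqrt (real n) * sqrt (real n)"
    using m_sqrt by (intro mult_strict_mono') auto
  then have mm: "m * m < n" by (simp flip: of_nat_mult)
  have "2 * m \<le> n"
  proof (cases "m = 1")
    case False
    then have "2 * m \<le> m * m" using assms(4) by (intro mult_le_mono1) simp
    then show ?thesis using mm by linarith
  qed (use assms(3) in simp)
  define k r where "k = (n - 2 * m) div m" and "r = (n - 2 * m) mod m"
  have n: "n = 2 * m + k * m + r" using \<open>2 * m \<le> n\<close> by (simp add: k_def r_def)
  have "r < m" using assms(4) by (simp add: r_def)
  \<comment> \<open>The aim is \<open>sqrt n \<le> a + k\<close>, which follows from this inequality
    and \<open>m < sqrt n\<close>.\<close>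
  have "real n \<le> real (a + k) * real m"
  proof -
    have "n \<le> (a + k) * m"
    \<comment> \<open>For \<open>m = 1\<close> the remainder \<open>r\<close> vanishes and
      \<open>a \<ge> 2\<close> suffices. Otherwise \<open>r < m\<close> gives
      \<open>n < 3 * m + k * m\<close>, and \<open>a > m \<ge> 2\<close> gives
      \<open>a \<ge> 3\<close>.\<close>
    proof (cases "m = 1")
      case True
      then show ?thesis using n \<open>r < m\<close> ma by simp
    next
      case False
      then have "m \<ge> 2" using assms(4) by simp
      then have "3 * m \<le> a * m" using ma by (intro mult_le_mono1) simp
      then have "n \<le> a * m + k * m" using n \<open>r < m\<close> by linarith
      then show ?thesis by (simp add: distrib_right)
    qed
    then show ?thesis by (metis of_nat_le_iff of_nat_mult)
  qed
  also have "\<dots> \<le> real (a + k) * sqrt (real n)"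
    using m_sqrt by (intro mult_left_mono) auto
  finally have "sqrt (real n) * sqrt (real n) \<le> real (a + k) * sqrt (real n)"
    by simp
  then have ak: "sqrt (real n) \<le> real (a + k)"
    using assms(3) by (elim mult_right_le_imp_le) simp
  have "card (closed_words_with_border \<Sigma> n m) * (a + k)
      \<le> a * ((a - 1) ^ k * ?q ^ r) * (a + k)"
    using card_closed_words_with_border_le_blocks[OF assms(1) n]
    unfolding a_def by (rule mult_le_mono1)
  also have "\<dots> = a * ?q ^ r * ((a - 1) ^ k * (a + k))" by (simp add: ac_simps)
  also have "\<dots> \<le> a * ?q ^ r * a ^ (k + 1)"
    using ma by (intro mult_le_mono2 pred_power_mult_add_le) simp
  \<comment> \<open>The exponents \<open>m\<close>, \<open>r\<close> and \<open>m * (k + 1)\<close>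
    add up to \<open>n\<close>.\<close>
  also have "\<dots> = ?q ^ n"
    unfolding n a_def by (simp add: ac_simps mult_2_right flip: power_add power_mult)
  finally have card_le: "card (closed_words_with_border \<Sigma> n m) * (a + k) \<le> ?q ^ n" .
  have "real (card (closed_words_with_border \<Sigma> n m)) * sqrt (real n)
      \<le> real (card (closed_words_with_border \<Sigma> n m)) * real (a + k)"
    using ak by (intro mult_left_mono) auto
  also have "\<dots> \<le> real ?q ^ n"
    using card_le by (metis of_nat_le_iff of_nat_mult of_nat_power)
  finally show ?thesis using assms(3) by (simp add: field_simps)
qed

section \<open>Summation over the border lengths\<close>

text \<open>The factor 2 reproduces itself under downward induction: the tail is at most
  \<open>2 * q ^ (n - M - 1)\<close>, hence at most the head term \<open>q ^ (n - M)\<close>,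
  because \<open>q \<ge> 2\<close>.\<close>

lemma sum_descending_powers_le:
  fixes q :: nat
  assumes "q > 1" "M \<le> n"
  shows "(\<Sum>m\<in>{M..<n}. q ^ (n - m)) \<le> 2 * q ^ (n - M)"
  using assms(2)
proof (induction M rule: inc_induct)
  case (step M)
  have "(\<Sum>m\<in>{M..<n}. q ^ (n - m)) = q ^ (n - M) + (\<Sum>m\<in>{Suc M..<n}. q ^ (n - m))"
    using step.hyps by (simp add: sum.atLeast_Suc_lessThan)
  also have "\<dots> \<le> q ^ (n - M) + 2 * q ^ (n - Suc M)" using step.IH by simp
  also have "2 * q ^ (n - Suc M) \<le> q * q ^ (n - Suc M)" using assms(1) by simp
  also have "q * q ^ (n - Suc M) = q ^ (n - M)"
    using step.hyps by (metis Suc_diff_Suc power_Suc)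
  finally show ?case by simp
qed simp

lemma num_closed_words_le_sum:
  assumes "finite \<Sigma>"
  shows "num_closed_words \<Sigma> n \<le> (\<Sum>m\<in>{1..<n}. card (closed_words_with_border \<Sigma> n m))"
proof -
  have "m \<in> {1..<n}" if "border w u" "length u = n" "length w = m" for w u :: "'a list" and m
    using that by (cases w) (auto simp: border_def)
  then have "{u \<in> lists \<Sigma>. length u = n \<and> closed_word u}
      \<subseteq> (\<Union>m\<in>{1..<n}. closed_words_with_border \<Sigma> n m)"
    unfolding closed_word_def closed_words_with_border_def by blast
  then have "num_closed_words \<Sigma> n \<le> card (\<Union>m\<in>{1..<n}. closed_words_with_border \<Sigma> n m)"
    unfolding num_closed_words_def using finite_closed_words_with_border[OF assms]
    by (intro card_mono) auto
  also have "\<dots> \<le> (\<Sum>m\<in>{1..<n}. card (closed_words_with_border \<Sigma> n m))"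
    by (rule card_UN_le) simp
  finally show ?thesis .
qed

lemma num_closed_words_le:
  assumes "finite \<Sigma>" "card \<Sigma> > 1" "n > 1"
  shows "real (num_closed_words \<Sigma> n)
    \<le> 3 / ln 2 * ln (real n) * (real (card \<Sigma>) ^ n / sqrt (real n))"
proof -
  let ?q = "card \<Sigma>"
  let ?c = "\<lambda>m. card (closed_words_with_border \<Sigma> n m)"
  let ?B = "real ?q ^ n / sqrt (real n)"
  define M where "M = (LEAST m. sqrt (real n) \<le> real ?q ^ m)"
  \<comment> \<open>The exponent \<open>n\<close> satisfies the condition defining \<open>M\<close>,
    so the least one exists and is at most \<open>n\<close>.\<close>
  have "n < 2 ^ n" by simp
  also have "2 ^ n \<le> ?q ^ n" using assms(2) by (intro power_mono) auto
  finally have "real n \<le> real ?q ^ n" by (metis less_imp_le of_nat_le_iff of_nat_power)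
  moreover have "sqrt (real n) \<le> real n" using assms(3) by (intro real_le_lsqrt) (auto simp: power2_eq_square)
  ultimately have ex: "sqrt (real n) \<le> real ?q ^ n" by linarith
  then have M: "sqrt (real n) \<le> real ?q ^ M" and "M \<le> n"
    unfolding M_def by (rule LeastI, rule Least_le)
  \<comment> \<open>Since \<open>q ^ 0 = 1 < sqrt n\<close>, the number \<open>M - 1\<close> is a
    genuine predecessor, and by minimality the condition fails there. This makes \<open>M\<close>
    logarithmic in \<open>n\<close>.\<close>
  have "M \<noteq> 0" using M assms(3) by (intro notI) simp
  then have "\<not> sqrt (real n) \<le> real ?q ^ (M - 1)"
    unfolding M_def by (intro not_less_Least) simp
  moreover have "(2::real) ^ (M - 1) \<le> real ?q ^ (M - 1)"
    using assms(2) by (intro power_mono) auto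
  ultimately have "(2::real) ^ (M - 1) < sqrt (real n)" by linarith
  then have "ln ((2::real) ^ (M - 1)) \<le> ln (sqrt (real n))"
    using assms(3) by (subst ln_le_cancel_iff) auto
  then have "2 * (real (M - 1) * ln 2) \<le> ln (real n)"
    using assms(3) by (simp add: ln_realpow ln_sqrt)
  moreover have "real (M - 1) * ln 2 \<ge> 0" by simp
  ultimately have lnM: "real (M - 1) * ln 2 \<le> ln (real n)" by linarith
  have ln2: "ln 2 \<le> ln (real n)" using assms(3) by simp
  have "(\<Sum>m\<in>{1..<M}. real (?c m)) \<le> of_nat (card {1..<M}) * ?B"
    using card_closed_words_with_border_le_sqrt[OF assms] by (intro sum_bounded_above) auto
  then have small: "(\<Sum>m\<in>{1..<M}. real (?c m)) \<le> real (M - 1) * ?B" by simp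
  have "(\<Sum>m\<in>{M..<n}. ?c m) \<le> (\<Sum>m\<in>{M..<n}. ?q ^ (n - m))"
    using card_closed_words_with_border_le_period[OF assms(1)] by (rule sum_mono)
  also have "\<dots> \<le> 2 * ?q ^ (n - M)"
    using assms(2) \<open>M \<le> n\<close> by (rule sum_descending_powers_le)
  finally have "real (\<Sum>m\<in>{M..<n}. ?c m) \<le> real (2 * ?q ^ (n - M))"
    by (rule of_nat_mono)
  also have "\<dots> \<le> 2 * ?B"
  proof -
    have "real ?q ^ (n - M) * sqrt (real n) \<le> real ?q ^ (n - M) * real ?q ^ M"
      using M by (intro mult_left_mono) auto
    also have "\<dots> = real ?q ^ n" using \<open>M \<le> n\<close> by (simp flip: power_add)
    finally show ?thesis using assms(3) by (simp add: field_simps)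
  qed
  finally have large: "(\<Sum>m\<in>{M..<n}. real (?c m)) \<le> 2 * ?B" by simp
  have "real (num_closed_words \<Sigma> n) \<le> (\<Sum>m\<in>{1..<n}. real (?c m))"
    using num_closed_words_le_sum[OF assms(1), of n] by (metis of_nat_le_iff of_nat_sum)
  also have "\<dots> = (\<Sum>m\<in>{1..<M}. real (?c m)) + (\<Sum>m\<in>{M..<n}. real (?c m))"
    using \<open>M \<noteq> 0\<close> \<open>M \<le> n\<close> by (subst sum.atLeastLessThan_concat) auto
  also have "\<dots> \<le> (real (M - 1) + 2) * ?B"
    unfolding distrib_right using small large by (rule add_mono)
  also have "\<dots> \<le> (3 / ln 2 * ln (real n)) * ?B"
  proof (rule mult_right_mono)
    \<comment> \<open>Source of the 3: the \<open>M - 1\<close> short lengths cost one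
      \<open>ln n / ln 2\<close>, and the 2 from the geometric series costs two more, as
      \<open>n \<ge> 2\<close>.\<close>
    have "(real (M - 1) + 2) * ln 2 \<le> 3 * ln (real n)"
      using lnM ln2 by (simp add: distrib_right)
    then show "real (M - 1) + 2 \<le> 3 / ln 2 * ln (real n)" by (simp add: field_simps)
  qed simp
  finally show ?thesis .
qed

theorem theorem2:
  fixes \<Sigma> :: "'a set" and q :: nat
  assumes "finite \<Sigma>" and "card \<Sigma> = q" and "q > 1"
  shows "\<exists>c::real. c > 0 \<and>
    (\<forall>n::nat. n > 1 \<longrightarrow>
      real (num_closed_words \<Sigma> n) \<le> c * ln (real n) * (real q ^ n / sqrt (real n)))"
proof (intro exI conjI allI impI)
  \<comment> \<open>The same constant serves every alphabet size \<open>q > 1\<close>.\<close>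
  show "3 / ln 2 > (0::real)" by simp
  fix n :: nat assume "n > 1"
  then show "real (num_closed_words \<Sigma> n)
      \<le> 3 / ln 2 * ln (real n) * (real q ^ n / sqrt (real n))"
    using num_closed_words_le[OF assms(1), of n] assms by simp
qed

end
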